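(* Let $n$ be a positive integer, and let $\beta\ge0$ and $c\ge n+\beta+1$ be integers such that at most one of $c-n-\beta-1$ and $\beta$ is zero. Then $$\det N_{c-\beta-1,\ \beta+2,\ c,\ c-n-\beta-1,\ \beta,\ n}=n.$$ Hence, for an infinite field $K$, the quotient of $K[x,y,z]$ by the ideal $$I_{c-\beta-1,\beta+2,c,c-n-\beta-1,\beta,n}=(x^{c-\beta-1},y^{\beta+2},z^c,x^{c-n-\beta-1}y^\beta z^n)$$ has the weak Lefschetz property when the characteristic of $K$ is either zero or not a prime divisor of $n$.
   Context: For integers $a,b,c,\alpha,\beta,\gamma$ with $0\le\alpha<a$, $0\le\beta<b$, $0\le\gamma<c$ and $a+b+c+\alpha+\beta+\gamma\equiv0\pmod3$, put $s=\frac13(a+b+c+\alpha+\beta+\gamma)-2$, $A=s+2-a$, $B=s+2-b$, $C=s+2-c$, $M=s+2-(\alpha+\beta+\gamma)$. When $0\le M$, $0\le A\le\beta+\gamma$, $0\le B\le\alpha+\gamma$, $0\le C\le\alpha+\beta$ (which hold for the parameters in the claim), $N_{a,b,c,\alpha,\beta,\gamma}$ is the $(C+M)\times(C+M)$ integer matrix with $(i,j)$ entry $\binom{c}{A+j-i}$ if $1\le i\le C$ and $\binom{\gamma}{A+C-\beta+j-i}$ if $C+1\le i\le C+M$, where $\binom mk=0$ if $k<0$ or $k>m$. An artinian standard graded $K$-algebra $Q$ has the weak Lefschetz property if there is a linear form $\ell\in[Q]_1$ such that for all integers $d$ the map $\times\ell:[Q]_d\to[Q]_{d+1}$ is injective or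 surjective. *)

theory Defs
  imports
    "HOL-Library.Poly_Mapping"
    "HOL-Algebra.QuotRing"
    "HOL-Algebra.Algebraic_Closure_Type"
    "Jordan_Normal_Form.Determinant"
begin

definition int_binomial :: "int \<Rightarrow> int \<Rightarrow> int" where
  "int_binomial m k = (if k < 0 \<or> k > m then 0 else int (nat m choose nat k))"

text \<open>The quantity \<open>s\<close> is integral only if \<open>a + b + c + \<alpha> + \<beta> + \<gamma>\<close> is divisible by 3; only
  such parameters are of interest.\<close>

definition par_s :: "int \<Rightarrow> int \<Rightarrow> int \<Rightarrow> int \<Rightarrow> int \<Rightarrow> int \<Rightarrow> int" where
  "par_s a b c \<alpha> \<beta> \<gamma> = (a + b + c + \<alpha> + \<beta> + \<gamma>) div 3 - 2"

definition par_A :: "int \<Rightarrow> int \<Rightarrow> int \<Rightarrow> int \<Rightarrow> int \<Rightarrow> int \<Rightarrow> int" where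
  "par_A a b c \<alpha> \<beta> \<gamma> = par_s a b c \<alpha> \<beta> \<gamma> + 2 - a"

definition par_C :: "int \<Rightarrow> int \<Rightarrow> int \<Rightarrow> int \<Rightarrow> int \<Rightarrow> int \<Rightarrow> int" where
  "par_C a b c \<alpha> \<beta> \<gamma> = par_s a b c \<alpha> \<beta> \<gamma> + 2 - c"

definition par_M :: "int \<Rightarrow> int \<Rightarrow> int \<Rightarrow> int \<Rightarrow> int \<Rightarrow> int \<Rightarrow> int" where
  "par_M a b c \<alpha> \<beta> \<gamma> = par_s a b c \<alpha> \<beta> \<gamma> + 2 - (\<alpha> + \<beta> + \<gamma>)"

text \<open>Matrix indices start at 0 here, so the 1-based row and column numbers are
  \<open>i = Suc i'\<close> and \<open>j = Suc j'\<close>.\<close>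

definition N_mat :: "int \<Rightarrow> int \<Rightarrow> int \<Rightarrow> int \<Rightarrow> int \<Rightarrow> int \<Rightarrow> int mat" where
  "N_mat a b c \<alpha> \<beta> \<gamma> =
    (let A = par_A a b c \<alpha> \<beta> \<gamma>; C = par_C a b c \<alpha> \<beta> \<gamma>; M = par_M a b c \<alpha> \<beta> \<gamma>
     in mat (nat (C + M)) (nat (C + M)) (\<lambda>(i', j').
          let i = int (Suc i'); j = int (Suc j')
          in if i \<le> C then int_binomial c (A + j - i)
             else int_binomial \<gamma> (A + C - \<beta> + j - i)))"

datatype var = VX | VY | VZ

text \<open>Polynomials in three variables as finitely supported functions from exponent vectors to
  coefficients; multiplication in this type is the convolution product.\<close>

type_synonym 'k poly3 = "(var \<Rightarrow>\<^sub>0 nat) \<Rightarrow>\<^sub>0 'k"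

definition Var :: "var \<Rightarrow> 'k::field poly3" where
  "Var v = Poly_Mapping.single (Poly_Mapping.single v 1) 1"

definition mdegree :: "(var \<Rightarrow>\<^sub>0 nat) \<Rightarrow> nat" where
  "mdegree m = (\<Sum>v\<in>Poly_Mapping.keys m. Poly_Mapping.lookup m v)"

text \<open>Graded pieces are indexed by all integers; for \<open>d < 0\<close> the following is \<open>{0}\<close>.\<close>

definition homogeneous_part :: "int \<Rightarrow> 'k::field poly3 set" where
  "homogeneous_part d = {p. \<forall>m\<in>Poly_Mapping.keys p. int (mdegree m) = d}"

abbreviation poly3_ring :: "'k::field poly3 ring" where
  "poly3_ring \<equiv> ring_of_type_algebra"

text \<open>The exponents are integers in order to match the parameters of \<^const>\<open>N_mat\<close>; they are
  meant to be nonnegative.\<close>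

definition I_ideal :: "int \<Rightarrow> int \<Rightarrow> int \<Rightarrow> int \<Rightarrow> int \<Rightarrow> int \<Rightarrow> 'k::field poly3 set" where
  "I_ideal a b c \<alpha> \<beta> \<gamma> = genideal poly3_ring
     {Var VX ^ nat a, Var VY ^ nat b, Var VZ ^ nat c,
      Var VX ^ nat \<alpha> * Var VY ^ nat \<beta> * Var VZ ^ nat \<gamma>}"

definition quotient_part :: "'k::field poly3 set \<Rightarrow> int \<Rightarrow> 'k poly3 set set" where
  "quotient_part I d = (\<lambda>p. I +>\<^bsub>poly3_ring\<^esub> p) ` homogeneous_part d"

text \<open>Here \<open>Q\<close> is a ring and \<open>G d\<close> its graded piece of degree \<open>d\<close>. The property is meant for
  artinian standard graded algebras over a field; quotients of the polynomial ring by
  homogeneous ideals containing a power of each variable are of this kind.\<close>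

definition weak_Lefschetz :: "('q, 'm) ring_scheme \<Rightarrow> (int \<Rightarrow> 'q set) \<Rightarrow> bool" where
  "weak_Lefschetz Q G \<longleftrightarrow>
    (\<exists>l\<in>G 1. \<forall>d. inj_on (\<lambda>q. l \<otimes>\<^bsub>Q\<^esub> q) (G d) \<or> (\<lambda>q. l \<otimes>\<^bsub>Q\<^esub> q) ` G d = G (d + 1))"

end

theory Submission
  imports Defs
begin

text \<open>
  For the parameters of the theorem \<open>C = 0\<close> and \<open>M = 1\<close>, so the matrix has the single entry
  \<open>n choose 1\<close>. The same number governs the weak Lefschetz property, because every ideal of the shape
  \<open>I = (x^(p+1), y^(q+1), z^(p+q+1), x^\<alpha> y^\<beta> z^\<gamma>)\<close> with \<open>\<alpha> + \<beta> + \<gamma> = p + q\<close> has it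
  as soon as \<open>\<gamma> choose (q - \<beta>)\<close> is nonzero in the field
  (\<open>weak_Lefschetz_if_binomial_nonzero\<close>).

  The Lefschetz element is \<open>l = x + y + z\<close>. Modulo \<open>l\<close>, \<open>x^(p+1)\<close> and \<open>y^(q+1)\<close> one may replace
  \<open>z\<close> by \<open>- (x + y)\<close>; what is left is \<open>K[x,y]/(x^(p+1), y^(q+1))\<close>, whose top degree \<open>p + q\<close> is
  spanned by \<open>x^p y^q\<close>. In that degree \<open>x^i y^j z^k\<close> becomes
  \<open>(- 1)^k (x + y)^k x^i y^j\<close>, that is \<open>(- 1)^k (k choose (q - j))\<close> times \<open>x^p y^q\<close>. This scalar is
  \<open>weight q j k\<close>, and the linear functional with these values on monomials (\<open>weight_sum\<close>)
  vanishes on all multiples of \<open>l\<close>.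

  Let \<open>w\<close> be the weight of the mixed generator \<open>x^\<alpha> y^\<beta> z^\<gamma>\<close>, which has degree \<open>p + q\<close>, and
  suppose that it is nonzero.

  \<^item> From a degree \<open>d \<ge> p + q - 1\<close> on, multiplication by \<open>l\<close> is surjective
    (\<open>lin_mult_surjective\<close>): the only class that could survive in the cokernel is that of \<open>x^p y^q\<close>,
    and the mixed generator makes \<open>w\<close> times that class vanish.

  \<^item> In degrees \<open>d \<le> p + q - 1\<close> it is injective (\<open>lin_mult_injective\<close>): if \<open>l f\<close> lies in \<open>I\<close>, then
    modulo \<open>(x^(p+1), y^(q+1))\<close> it is at most a multiple \<open>u x^\<alpha> y^\<beta> z^\<gamma>\<close>; the functional gives
    \<open>u w = 0\<close>, hence \<open>u = 0\<close>; and \<open>l\<close>, being monic in \<open>z\<close>, is not a zero divisor modulo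
    \<open>(x^(p+1), y^(q+1))\<close>.

  The theorem is the case \<open>p = c - \<beta> - 2\<close>, \<open>q = \<beta> + 1\<close>, \<open>\<gamma> = n\<close>.
\<close>

section \<open>Exponent vectors and coefficients\<close>

definition expo :: "nat \<Rightarrow> nat \<Rightarrow> nat \<Rightarrow> var \<Rightarrow>\<^sub>0 nat" where
  "expo i j k = Poly_Mapping.single VX i + Poly_Mapping.single VY j + Poly_Mapping.single VZ k"

lemma lookup_expo [simp]:
  "Poly_Mapping.lookup (expo i j k) VX = i"
  "Poly_Mapping.lookup (expo i j k) VY = j"
  "Poly_Mapping.lookup (expo i j k) VZ = k"
  by (simp_all add: expo_def lookup_add lookup_single)

lemma expo_lookup:
  "expo (Poly_Mapping.lookup m VX) (Poly_Mapping.lookup m VY) (Poly_Mapping.lookup m VZ) = m"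
proof (rule poly_mapping_eqI)
  show "Poly_Mapping.lookup (expo (Poly_Mapping.lookup m VX) (Poly_Mapping.lookup m VY)
          (Poly_Mapping.lookup m VZ)) v = Poly_Mapping.lookup m v" for v
    by (cases v) simp_all
qed

lemma expo_cases: obtains i j k where "m = expo i j k"
  using expo_lookup[of m] by metis

lemma expo_eq_iff [simp]: "expo i j k = expo i' j' k' \<longleftrightarrow> i = i' \<and> j = j' \<and> k = k'"
  by (metis lookup_expo)

lemma expo_add: "expo i j k + expo i' j' k' = expo (i + i') (j + j') (k + k')"
  by (simp add: expo_def single_add ac_simps)

lemma mdegree_expo [simp]: "mdegree (expo i j k) = i + j + k"
proof -
  have UNIV: "(UNIV :: var set) = {VX, VY, VZ}"
    using var.exhaust by blast
  have "mdegree (expo i j k) = (\<Sum>v\<in>UNIV. Poly_Mapping.lookup (expo i j k) v)"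
    unfolding mdegree_def by (rule sum.mono_neutral_left) (use var.exhaust in \<open>auto simp: UNIV in_keys_iff\<close>)
  then show ?thesis
    by (simp add: UNIV)
qed

lemma Var_expo:
  "Var VX = Poly_Mapping.single (expo 1 0 0) 1"
  "Var VY = Poly_Mapping.single (expo 0 1 0) 1"
  "Var VZ = Poly_Mapping.single (expo 0 0 1) 1"
  by (simp_all add: Var_def expo_def)

lemma Var_power:
  "(Var VX :: 'k::field poly3) ^ i = Poly_Mapping.single (expo i 0 0) 1"
  "(Var VY :: 'k::field poly3) ^ i = Poly_Mapping.single (expo 0 i 0) 1"
  "(Var VZ :: 'k::field poly3) ^ i = Poly_Mapping.single (expo 0 0 i) 1"
proof -
  have one: "Poly_Mapping.single (expo 0 0 0) (1::'k) = 1"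
    by (simp add: expo_def)
  show "(Var VX :: 'k poly3) ^ i = Poly_Mapping.single (expo i 0 0) 1"
    by (induction i) (simp_all add: one Var_expo mult_single expo_add)
  show "(Var VY :: 'k poly3) ^ i = Poly_Mapping.single (expo 0 i 0) 1"
    by (induction i) (simp_all add: one Var_expo mult_single expo_add)
  show "(Var VZ :: 'k poly3) ^ i = Poly_Mapping.single (expo 0 0 i) 1"
    by (induction i) (simp_all add: one Var_expo mult_single expo_add)
qed

lemma poly_mapping_sum_singles:
  fixes f :: "'a \<Rightarrow>\<^sub>0 'b::comm_monoid_add"
  shows "f = (\<Sum>m\<in>Poly_Mapping.keys f. Poly_Mapping.single m (Poly_Mapping.lookup f m))"
  by (rule poly_mapping_eqI) (simp add: lookup_sum lookup_single when_def in_keys_iff)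

text \<open>Additive statements about a polynomial need only be checked on its own terms. The hypothesis
  is restricted to terms that occur in \<open>f\<close> so that support conditions such as homogeneity or
  membership in a monomial ideal can be used.\<close>

lemma poly_mapping_terms_induct:
  fixes f :: "'a \<Rightarrow>\<^sub>0 'b::comm_monoid_add"
  assumes "P 0"
    and "\<And>m. m \<in> Poly_Mapping.keys f \<Longrightarrow> P (Poly_Mapping.single m (Poly_Mapping.lookup f m))"
    and "\<And>g h. P g \<Longrightarrow> P h \<Longrightarrow> P (g + h)"
  shows "P f"
proof -
  have "P (\<Sum>m\<in>A. Poly_Mapping.single m (Poly_Mapping.lookup f m))"
    if "A \<subseteq> Poly_Mapping.keys f" for A
    using finite_subset[OF that finite_keys] that
    by (induction A rule: finite_induct) (use assms in auto)
  then show ?thesis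
    using poly_mapping_sum_singles[of f] by force
qed

section \<open>The linear form\<close>

definition lin :: "'k::field poly3" where
  "lin = Var VX + Var VY + Var VZ"

lemma lin_mult_single:
  "lin * Poly_Mapping.single (expo i j k) u =
     Poly_Mapping.single (expo (Suc i) j k) u + Poly_Mapping.single (expo i (Suc j) k) u +
     Poly_Mapping.single (expo i j (Suc k)) u"
  by (simp add: lin_def Var_expo distrib_right mult_single expo_add)

text \<open>The coefficient of \<open>x^i y^j z^k\<close> in \<open>f\<close> is expressed by one of \<open>l f\<close> and by coefficients of \<open>f\<close>
  with smaller \<open>i + j\<close>. This recursion is the reason why \<open>l\<close> is not a zero divisor modulo
  \<open>(x^(p+1), y^(q+1))\<close>.\<close>

lemma lookup_lin_mult:
  "Poly_Mapping.lookup (lin * f) (expo i j (Suc k)) =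
     Poly_Mapping.lookup f (expo i j k) +
     (case i of 0 \<Rightarrow> 0 | Suc i' \<Rightarrow> Poly_Mapping.lookup f (expo i' j (Suc k))) +
     (case j of 0 \<Rightarrow> 0 | Suc j' \<Rightarrow> Poly_Mapping.lookup f (expo i j' (Suc k)))"
proof (induction f rule: poly_mapping_terms_induct)
  case (2 m)
  show ?case
    by (cases m rule: expo_cases)
      (auto simp: lin_mult_single lookup_add lookup_single when_def split: nat.splits)
next
  case (3 g h)
  then show ?case
    by (simp add: distrib_left lookup_add split: nat.splits)
qed (simp split: nat.splits)

lemma lin_mult_homogeneous:
  assumes "f \<in> homogeneous_part d"
  shows "lin * f \<in> homogeneous_part (d + 1)"
  unfolding homogeneous_part_def
proof (intro CollectI ballI)
  fix m
  assume "m \<in> Poly_Mapping.keys (lin * f)"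
  then obtain e m' where m: "m = e + m'" and e: "e \<in> Poly_Mapping.keys (lin :: 'a poly3)"
    and m': "m' \<in> Poly_Mapping.keys f"
    using keys_mult[of lin f] by blast
  have "e \<in> {expo 1 0 0, expo 0 1 0, expo 0 0 1}"
    using e keys_add[of "Var VX + Var VY" "Var VZ :: 'a poly3"]
      keys_add[of "Var VX" "Var VY :: 'a poly3"]
    by (auto simp: lin_def Var_expo split: if_splits)
  then show "int (mdegree m) = d + 1"
    using assms m' m by (cases m' rule: expo_cases) (auto simp: homogeneous_part_def expo_add)
qed

section \<open>The monomial ideal\<close>

definition multiples :: "nat \<Rightarrow> nat \<Rightarrow> nat \<Rightarrow> nat \<Rightarrow> nat \<Rightarrow> nat \<Rightarrow> (var \<Rightarrow>\<^sub>0 nat) set" where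
  "multiples a b c \<alpha> \<beta> \<gamma> = {expo i j k |i j k. a \<le> i \<or> b \<le> j \<or> c \<le> k \<or> (\<alpha> \<le> i \<and> \<beta> \<le> j \<and> \<gamma> \<le> k)}"

lemma expo_in_multiples [simp]:
  "expo i j k \<in> multiples a b c \<alpha> \<beta> \<gamma> \<longleftrightarrow>
     a \<le> i \<or> b \<le> j \<or> c \<le> k \<or> (\<alpha> \<le> i \<and> \<beta> \<le> j \<and> \<gamma> \<le> k)"
  by (auto simp: multiples_def)

lemma poly3_ring_simps [simp]:
  "carrier (poly3_ring :: 'k::field poly3 ring) = UNIV"
  "x \<otimes>\<^bsub>(poly3_ring :: 'k::field poly3 ring)\<^esub> y = x * y"
  "x \<oplus>\<^bsub>(poly3_ring :: 'k::field poly3 ring)\<^esub> y = x + y"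
  "\<zero>\<^bsub>(poly3_ring :: 'k::field poly3 ring)\<^esub> = 0"
  by (simp_all add: ring_of_type_algebra_def)

lemma poly3_cring: "cring (poly3_ring :: 'k::field poly3 ring)"
  by (rule cring_from_type_algebra)

lemma poly3_ring_a_minus [simp]:
  "x \<ominus>\<^bsub>(poly3_ring :: 'k::field poly3 ring)\<^esub> y = x - y"
proof -
  interpret cring "poly3_ring :: 'k poly3 ring" by (rule poly3_cring)
  have "\<ominus>\<^bsub>poly3_ring\<^esub> y = - y"
    by (rule minus_equality) simp_all
  then show ?thesis
    by (simp add: a_minus_def)
qed

lemma I_ideal_is_ideal: "ideal (I_ideal a b c \<alpha> \<beta> \<gamma> :: 'k::field poly3 set) poly3_ring"
proof -
  interpret cring "poly3_ring :: 'k poly3 ring" by (rule poly3_cring)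
  show ?thesis
    unfolding I_ideal_def by (rule genideal_ideal) simp
qed

lemma monomial_ideal_is_ideal:
  assumes "\<And>m m'. m \<in> S \<Longrightarrow> m' + m \<in> S"
  shows "ideal {f :: 'k::field poly3. Poly_Mapping.keys f \<subseteq> S} poly3_ring"
proof -
  interpret cring "poly3_ring :: 'k poly3 ring" by (rule poly3_cring)
  let ?J = "{f :: 'k poly3. Poly_Mapping.keys f \<subseteq> S}"
  have mult: "g * f \<in> ?J" if "f \<in> ?J" for f g :: "'k poly3"
    using keys_mult[of g f] that assms by fastforce
  have add: "f + g \<in> ?J" if "f \<in> ?J" "g \<in> ?J" for f g :: "'k poly3"
    using keys_add[of f g] that by fastforce
  have uminus: "- f \<in> ?J" if "f \<in> ?J" for f :: "'k poly3"
    using mult[OF that, of "-1"] by simp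
  have "additive_subgroup ?J (poly3_ring :: 'k poly3 ring)"
  proof (rule additive_subgroupI, rule add.subgroupI)
    fix f :: "'k poly3"
    assume f: "f \<in> ?J"
    have "\<ominus>\<^bsub>poly3_ring\<^esub> f = - f"
      by (rule minus_equality) simp_all
    then show "\<ominus>\<^bsub>poly3_ring\<^esub> f \<in> ?J"
      using uminus[OF f] by simp
  qed (use add in \<open>auto intro: exI[of _ 0]\<close>)
  then show ?thesis
    by (intro idealI ring_axioms additive_subgroup.a_subgroup)
      (use mult in \<open>auto simp: mult.commute\<close>)
qed

text \<open>Membership in an ideal generated by monomials can be read off the support: the polynomials
  supported on multiples of the generators form an ideal, and each of their terms is a multiple of
  a generator.\<close>

lemma I_ideal_eq:
  "(I_ideal a b c \<alpha> \<beta> \<gamma> :: 'k::field poly3 set) =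
     {f. Poly_Mapping.keys f \<subseteq> multiples (nat a) (nat b) (nat c) (nat \<alpha>) (nat \<beta>) (nat \<gamma>)}"
  (is "_ = ?J")
proof
  interpret cring "poly3_ring :: 'k poly3 ring" by (rule poly3_cring)
  interpret I: ideal "I_ideal a b c \<alpha> \<beta> \<gamma> :: 'k poly3 set" poly3_ring
    by (rule I_ideal_is_ideal)
  let ?S = "multiples (nat a) (nat b) (nat c) (nat \<alpha>) (nat \<beta>) (nat \<gamma>)"
  let ?G = "{Var VX ^ nat a, Var VY ^ nat b, Var VZ ^ nat c,
      Var VX ^ nat \<alpha> * Var VY ^ nat \<beta> * Var VZ ^ nat \<gamma>} :: 'k poly3 set"
  have G: "?G = (\<lambda>m. Poly_Mapping.single m 1) ` {expo (nat a) 0 0, expo 0 (nat b) 0, expo 0 0 (nat c),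
      expo (nat \<alpha>) (nat \<beta>) (nat \<gamma>)}"
    by (simp add: Var_power mult_single expo_add)
  have "ideal ?J poly3_ring"
  proof (rule monomial_ideal_is_ideal)
    show "m' + m \<in> ?S" if "m \<in> ?S" for m m'
      using that by (cases m rule: expo_cases; cases m' rule: expo_cases) (auto simp: expo_add)
  qed
  moreover have "?G \<subseteq> ?J"
    unfolding G by auto
  ultimately show "I_ideal a b c \<alpha> \<beta> \<gamma> \<subseteq> ?J"
    unfolding I_ideal_def by (rule genideal_minimal)
  have gen: "?G \<subseteq> I_ideal a b c \<alpha> \<beta> \<gamma>"
    unfolding I_ideal_def by (rule genideal_self) simp
  have multiple: "Poly_Mapping.single (m' + m) u \<in> I_ideal a b c \<alpha> \<beta> \<gamma>"
    if "Poly_Mapping.single m (1 :: 'k) \<in> I_ideal a b c \<alpha> \<beta> \<gamma>" for m m' and u :: 'k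
    using I.I_l_closed[OF that, of "Poly_Mapping.single m' u"] by (simp add: mult_single)
  have single: "Poly_Mapping.single m u \<in> I_ideal a b c \<alpha> \<beta> \<gamma>" if mS: "m \<in> ?S" for m and u :: 'k
  proof -
    obtain i j k where m: "m = expo i j k" by (rule expo_cases)
    obtain i' j' k' where "expo i' j' k' \<in> {expo (nat a) 0 0, expo 0 (nat b) 0, expo 0 0 (nat c),
        expo (nat \<alpha>) (nat \<beta>) (nat \<gamma>)}" and le: "i' \<le> i" "j' \<le> j" "k' \<le> k"
      using mS unfolding m expo_in_multiples by (metis insertCI le0)
    then have "Poly_Mapping.single (expo i' j' k') (1 :: 'k) \<in> I_ideal a b c \<alpha> \<beta> \<gamma>"
      using gen unfolding G by blast
    from multiple[OF this, of "expo (i - i') (j - j') (k - k')" u] show ?thesis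
      using le by (simp add: expo_add m)
  qed
  show "?J \<subseteq> I_ideal a b c \<alpha> \<beta> \<gamma>"
  proof
    fix f :: "'k poly3"
    assume f: "f \<in> ?J"
    show "f \<in> I_ideal a b c \<alpha> \<beta> \<gamma>"
    proof (induction f rule: poly_mapping_terms_induct)
      case 1
      then show ?case using I.zero_closed by simp
    next
      case (2 m)
      then show ?case using f single by blast
    next
      case (3 g h)
      then show ?case using I.a_closed by simp
    qed
  qed
qed

section \<open>Reduction of the weak Lefschetz property to polynomials\<close>

text \<open>Graded pieces of the quotient consist of cosets of homogeneous polynomials, and the coset map is
  multiplicative; so injectivity and surjectivity can be tested on representatives.\<close>

lemma weak_Lefschetz_quotientI:
  fixes I :: "'k::field poly3 set" and l :: "'k poly3"
  assumes I: "ideal I poly3_ring"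
    and l: "l \<in> homogeneous_part 1"
    and closed: "\<And>d f. f \<in> homogeneous_part d \<Longrightarrow> l * f \<in> homogeneous_part (d + 1)"
    and inj_or_surj: "\<And>d.
      (\<forall>f\<in>homogeneous_part d. l * f \<in> I \<longrightarrow> f \<in> I) \<or>
      (\<forall>g\<in>homogeneous_part (d + 1). \<exists>f\<in>homogeneous_part d. g - l * f \<in> I)"
  shows "weak_Lefschetz (poly3_ring Quot I) (quotient_part I)"
proof -
  interpret cring "poly3_ring :: 'k poly3 ring" by (rule poly3_cring)
  interpret I: ideal I poly3_ring by (rule I)
  have eq: "I +>\<^bsub>poly3_ring\<^esub> f = I +>\<^bsub>poly3_ring\<^esub> g \<longleftrightarrow> f - g \<in> I" for f g
    using quotient_eq_iff_same_a_r_cos[OF I, of f g] by simp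
  have mult: "(I +>\<^bsub>poly3_ring\<^esub> l) \<otimes>\<^bsub>poly3_ring Quot I\<^esub> (I +>\<^bsub>poly3_ring\<^esub> f) =
      I +>\<^bsub>poly3_ring\<^esub> (l * f)" for f
    using I.rcoset_mult_add[of l f] by (simp add: FactRing_def)
  have diff: "f - g \<in> homogeneous_part d"
    if "f \<in> homogeneous_part d" "g \<in> homogeneous_part d" for f g :: "'k poly3" and d
    using that keys_diff[of f g] by (auto simp: homogeneous_part_def)
  show ?thesis
    unfolding weak_Lefschetz_def
  proof (intro bexI allI)
    show "I +>\<^bsub>poly3_ring\<^esub> l \<in> quotient_part I 1"
      using l by (simp add: quotient_part_def)
    fix d
    from inj_or_surj[of d]
    show "inj_on (\<lambda>q. (I +>\<^bsub>poly3_ring\<^esub> l) \<otimes>\<^bsub>poly3_ring Quot I\<^esub> q) (quotient_part I d) \<or>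
      (\<lambda>q. (I +>\<^bsub>poly3_ring\<^esub> l) \<otimes>\<^bsub>poly3_ring Quot I\<^esub> q) ` quotient_part I d = quotient_part I (d + 1)"
    proof (elim disjE)
      assume inj: "\<forall>f\<in>homogeneous_part d. l * f \<in> I \<longrightarrow> f \<in> I"
      show ?thesis
        by (rule disjI1)
          (use inj diff in \<open>auto simp: inj_on_def quotient_part_def mult eq simp flip: right_diff_distrib\<close>)
    next
      assume "\<forall>g\<in>homogeneous_part (d + 1). \<exists>f\<in>homogeneous_part d. g - l * f \<in> I"
      then show ?thesis
        by (intro disjI2) (auto simp: quotient_part_def mult image_image closed eq image_iff)
    qed
  qed
qed

section \<open>Alternating binomial weights\<close>

text \<open>The coefficient of \<open>x^p y^q\<close> in \<open>x^i y^j (- (x + y))^k\<close> when \<open>i + j + k = p + q\<close>; since it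
  does not depend on \<open>i\<close> and \<open>p\<close>, these are left out of the arguments.\<close>

definition weight :: "nat \<Rightarrow> nat \<Rightarrow> nat \<Rightarrow> 'k::field" where
  "weight q j k = (if j \<le> q then (- 1) ^ k * of_nat (k choose (q - j)) else 0)"

text \<open>Pascal's rule, in the form that expresses \<open>x + y + z = 0\<close>.\<close>

lemma weight_Pascal: "weight q (Suc j) k + weight q j k + weight q j (Suc k) = 0"
proof (cases "j < q")
  case True
  then obtain r where "q = Suc (j + r)"
    using less_imp_Suc_add by blast
  then show ?thesis
    by (simp add: weight_def algebra_simps)
qed (auto simp: weight_def)

definition weight_sum :: "nat \<Rightarrow> 'k::field poly3 \<Rightarrow> 'k" where
  "weight_sum q f = (\<Sum>m\<in>Poly_Mapping.keys f. Poly_Mapping.lookup f m *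
     weight q (Poly_Mapping.lookup m VY) (Poly_Mapping.lookup m VZ))"

lemma weight_sum_add: "weight_sum q (f + g) = weight_sum q f + weight_sum q g"
  unfolding weight_sum_def by (rule setsum_keys_plus_distrib) (simp_all add: distrib_right)

lemma weight_sum_single:
  "weight_sum q (Poly_Mapping.single (expo i j k) u) = u * weight q j k"
  by (simp add: weight_sum_def)

lemma weight_sum_lin_mult: "weight_sum q (lin * f) = 0"
proof (induction f rule: poly_mapping_terms_induct)
  case 1
  show ?case by (simp add: weight_sum_def)
next
  case (2 m)
  obtain i j k where m: "m = expo i j k" by (rule expo_cases)
  have "weight_sum q (lin * Poly_Mapping.single m u) = 0" for u
  proof -
    have "weight_sum q (lin * Poly_Mapping.single m u) =
        u * (weight q (Suc j) k + weight q j k + weight q j (Suc k))"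
      by (simp add: m lin_mult_single weight_sum_add weight_sum_single algebra_simps)
    then show ?thesis
      by (simp add: weight_Pascal)
  qed
  then show ?case .
next
  case (3 g h)
  then show ?case by (simp add: distrib_left weight_sum_add)
qed

section \<open>Injectivity and surjectivity\<close>

text \<open>If the product of \<open>l\<close> with \<open>f\<close> lies in \<open>I\<close>, then its only term of exponents \<open>i \<le> p\<close> and
  \<open>j \<le> q\<close> can be the mixed generator itself, as its degree is at most \<open>p + q\<close>. The functional
  \<open>weight_sum\<close> excludes this term, and then the coefficients of \<open>f\<close> with \<open>i \<le> p\<close> and
  \<open>j \<le> q\<close> vanish one after the other, by induction on \<open>i + j\<close>.\<close>

lemma lin_mult_injective:
  fixes f :: "'k::field poly3"
  assumes sum: "\<alpha> + \<beta> + \<gamma> = p + q"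
    and w: "weight q \<beta> \<gamma> \<noteq> (0 :: 'k)"
    and d: "d < int (p + q)"
    and f: "f \<in> homogeneous_part d"
    and lf: "Poly_Mapping.keys (lin * f) \<subseteq> multiples (Suc p) (Suc q) (Suc (p + q)) \<alpha> \<beta> \<gamma>"
  shows "Poly_Mapping.keys f \<subseteq> multiples (Suc p) (Suc q) (Suc (p + q)) \<alpha> \<beta> \<gamma>"
proof -
  let ?S = "multiples (Suc p) (Suc q) (Suc (p + q)) \<alpha> \<beta> \<gamma>"
  let ?m = "expo \<alpha> \<beta> \<gamma>"
  have deg: "int (i + j + k) = d + 1" if "expo i j k \<in> Poly_Mapping.keys (lin * f)" for i j k
    using lin_mult_homogeneous[OF f] that by (force simp: homogeneous_part_def)
  have corner: "Poly_Mapping.lookup (lin * f) ?m = 0"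
  proof (rule ccontr)
    assume nz: "Poly_Mapping.lookup (lin * f) ?m \<noteq> 0"
    then have d_eq: "d + 1 = int (p + q)"
      using deg[of \<alpha> \<beta> \<gamma>] sum by (simp add: in_keys_iff)
    have "weight_sum q (lin * f) = (\<Sum>m\<in>{?m}. Poly_Mapping.lookup (lin * f) m *
        weight q (Poly_Mapping.lookup m VY) (Poly_Mapping.lookup m VZ))"
      unfolding weight_sum_def
    proof (rule sum.mono_neutral_right)
      show "\<forall>m\<in>Poly_Mapping.keys (lin * f) - {?m}. Poly_Mapping.lookup (lin * f) m *
          weight q (Poly_Mapping.lookup m VY) (Poly_Mapping.lookup m VZ) = 0"
      proof
        fix m
        assume m: "m \<in> Poly_Mapping.keys (lin * f) - {?m}"
        obtain i j k where ijk: "m = expo i j k" by (rule expo_cases)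
        have deg': "i + j + k = p + q"
          using deg[of i j k] m ijk d_eq by simp
        \<comment> \<open>In degree \<open>p + q\<close> the generator \<open>z^(p+q+1)\<close> has no multiples, and the mixed
          generator only itself.\<close>
        have "p < i \<or> q < j"
          using m lf deg' sum unfolding ijk by fastforce
        \<comment> \<open>If \<open>p < i\<close>, then \<open>k < q - j\<close>, so that the binomial coefficient vanishes.\<close>
        then have "weight q j k = (0 :: 'k)"
          using deg' by (auto simp: weight_def binomial_eq_0)
        then show "Poly_Mapping.lookup (lin * f) m *
          weight q (Poly_Mapping.lookup m VY) (Poly_Mapping.lookup m VZ) = 0"
          by (simp add: ijk)
      qed
    qed (use nz in \<open>simp_all add: in_keys_iff\<close>)
    then show False
      using nz w weight_sum_lin_mult[of q f] by simp
  qed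
  have lf_zero: "Poly_Mapping.lookup (lin * f) (expo i j k) = 0" if "i \<le> p" "j \<le> q" for i j k
  proof (rule ccontr)
    assume nz: "Poly_Mapping.lookup (lin * f) (expo i j k) \<noteq> 0"
    then have key: "expo i j k \<in> Poly_Mapping.keys (lin * f)"
      by (simp add: in_keys_iff)
    then have "i + j + k \<le> p + q" and "expo i j k \<in> ?S"
      using deg d lf by fastforce+
    then have "expo i j k = ?m"
      using that sum by auto
    then show False
      using nz corner by simp
  qed
  have f_zero: "Poly_Mapping.lookup f (expo i j k) = 0" if "i \<le> p" "j \<le> q" for i j k
    using that
  proof (induction "i + j" arbitrary: i j k rule: less_induct)
    case less
    then show ?case
      using lookup_lin_mult[of f i j k] lf_zero[of i j "Suc k"] by (simp split: nat.splits)
  qed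
  show ?thesis
  proof
    fix m
    assume m: "m \<in> Poly_Mapping.keys f"
    obtain i j k where "m = expo i j k" by (rule expo_cases)
    then show "m \<in> ?S"
      using m f_zero[of i j k] by (force simp: in_keys_iff)
  qed
qed

text \<open>Every monomial of degree \<open>d + 1\<close> is reduced, by the relation \<open>z = - x - y\<close> in the cokernel, to its
  weight times a monomial \<open>x^r y^q\<close>. The latter vanishes in the cokernel: if \<open>d + 1 > p + q\<close>,
  then \<open>x^(p+1)\<close> divides it; if \<open>d + 1 = p + q\<close>, then the reduction of the mixed generator is a
  nonzero multiple of it.\<close>

lemma lin_mult_surjective:
  fixes g :: "'k::field poly3"
  assumes sum: "\<alpha> + \<beta> + \<gamma> = p + q"
    and w: "weight q \<beta> \<gamma> \<noteq> (0 :: 'k)"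
    and d: "int (p + q) \<le> d + 1"
    and g: "g \<in> homogeneous_part (d + 1)"
  defines "S \<equiv> multiples (Suc p) (Suc q) (Suc (p + q)) \<alpha> \<beta> \<gamma>"
  shows "\<exists>f\<in>homogeneous_part d. Poly_Mapping.keys (g - lin * f) \<subseteq> S"
proof -
  \<comment> \<open>\<open>T\<close> consists of the polynomials that represent zero in the cokernel.\<close>
  define T :: "'k poly3 set" where
    "T = {h. \<exists>f\<in>homogeneous_part d. Poly_Mapping.keys (h - lin * f) \<subseteq> S}"
  \<comment> \<open>\<open>x^r y^q\<close> is the monomial of degree \<open>d + 1\<close> whose class spans the quotient by
    \<open>l\<close>, \<open>x^(r+1)\<close> and \<open>y^(q+1)\<close> in this degree.\<close>
  define r where "r = nat (d + 1) - q"
  have r: "int (r + q) = d + 1" "p \<le> r"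
    using d by (simp_all add: r_def)
  have T_diff: "h - h' \<in> T" if hT: "h \<in> T" "h' \<in> T" for h h'
  proof -
    obtain f f' where f: "f \<in> homogeneous_part d" "Poly_Mapping.keys (h - lin * f) \<subseteq> S"
      and f': "f' \<in> homogeneous_part d" "Poly_Mapping.keys (h' - lin * f') \<subseteq> S"
      using hT unfolding T_def by blast
    have "(h - h') - lin * (f - f') = (h - lin * f) - (h' - lin * f')"
      by (simp add: right_diff_distrib)
    then have "Poly_Mapping.keys ((h - h') - lin * (f - f')) \<subseteq> S"
      using keys_diff[of "h - lin * f" "h' - lin * f'"] f f' by (simp only:) blast
    moreover have "f - f' \<in> homogeneous_part d"
      using f f' keys_diff[of f f'] by (auto simp: homogeneous_part_def)
    ultimately show ?thesis
      unfolding T_def by blast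
  qed
  have T_ideal: "h \<in> T" if "Poly_Mapping.keys h \<subseteq> S" for h
    unfolding T_def using that by (intro CollectI bexI[of _ 0]) (simp_all add: homogeneous_part_def)
  have T_add: "h + h' \<in> T" if "h \<in> T" "h' \<in> T" for h h'
    using T_diff[OF that(1) T_diff[OF T_ideal[of 0] that(2)]] by simp
  have T_lin: "lin * f \<in> T" if "f \<in> homogeneous_part d" for f
    unfolding T_def using that by (intro CollectI bexI[of _ f]) simp_all
  have reduce: "Poly_Mapping.single (expo i j k) u -
      Poly_Mapping.single (expo r q 0) (u * weight q j k) \<in> T"
    if "int (i + j + k) = d + 1" for i j k u
    using that
  proof (induction k arbitrary: i j)
    case 0
    then have ij: "i + j = r + q"
      using r by linarith
    \<comment> \<open>With \<open>z\<close> eliminated, every monomial other than \<open>x^r y^q\<close> is a multiple of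
      \<open>x^(p+1)\<close> or \<open>y^(q+1)\<close>.\<close>
    consider "j = q" | "q < j" | "p < i" "j < q"
      using ij r by linarith
    then show ?case
    proof cases
      case 1
      then show ?thesis
        using ij T_ideal[of 0] by (simp add: weight_def)
    next
      case 2
      then show ?thesis
        by (intro T_ideal) (auto simp: weight_def S_def)
    next
      case 3
      then show ?thesis
        by (intro T_ideal) (auto simp: weight_def S_def binomial_eq_0)
    qed
  next
    case (Suc k)
    let ?t = "\<lambda>i j k. Poly_Mapping.single (expo i j k) u :: 'k poly3"
    let ?c = "\<lambda>j k. Poly_Mapping.single (expo r q 0) (u * weight q j k) :: 'k poly3"
    have "lin * ?t i j k - (?t (Suc i) j k - ?c j k) - (?t i (Suc j) k - ?c (Suc j) k) \<in> T"
    proof (rule T_diff[OF T_diff])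
      show "lin * ?t i j k \<in> T"
        using Suc.prems by (intro T_lin) (simp add: homogeneous_part_def)
    qed (use Suc.IH[of "Suc i" j] Suc.IH[of i "Suc j"] Suc.prems in simp_all)
    moreover have "weight q j (Suc k) = - weight q j k - (weight q (Suc j) k :: 'k)"
      using weight_Pascal[of q j k, where 'a = 'k] by (simp add: algebra_simps eq_neg_iff_add_eq_0)
    then have "?c j (Suc k) = - ?c j k - ?c (Suc j) k"
      by (simp add: right_diff_distrib single_diff single_uminus)
    then have "?t i j (Suc k) - ?c j (Suc k) =
        lin * ?t i j k - (?t (Suc i) j k - ?c j k) - (?t i (Suc j) k - ?c (Suc j) k)"
      by (simp only: lin_mult_single) (simp add: algebra_simps)
    ultimately show ?case
      by (simp only:)
  qed
  have top: "Poly_Mapping.single (expo r q 0) u \<in> T" for u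
  proof (cases "r = p")
    case True
    let ?u = "u / weight q \<beta> \<gamma>"
    have "Poly_Mapping.single (expo \<alpha> \<beta> \<gamma>) ?u \<in> T"
      by (intro T_ideal) (auto simp: S_def)
    moreover have "Poly_Mapping.single (expo \<alpha> \<beta> \<gamma>) ?u - Poly_Mapping.single (expo r q 0) u \<in> T"
      using reduce[of \<alpha> \<beta> \<gamma> ?u] w sum r True by simp
    ultimately show ?thesis
      using T_diff by fastforce
  next
    case False
    then show ?thesis
      using r by (intro T_ideal) (auto simp: S_def)
  qed
  have "g \<in> T"
  proof (induction g rule: poly_mapping_terms_induct)
    case 1
    show ?case by (rule T_ideal) simp
  next
    case (2 m)
    obtain i j k where m: "m = expo i j k" by (rule expo_cases)
    have "int (i + j + k) = d + 1"
      using 2 g m by (force simp: homogeneous_part_def)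
    then show ?case
      using T_add[OF reduce top, of i j k "Poly_Mapping.lookup g m"
        "Poly_Mapping.lookup g m * weight q j k"]
      by (simp add: m)
  next
    case (3 g h)
    then show ?case by (rule T_add)
  qed
  then show ?thesis
    by (simp add: T_def)
qed

text \<open>The degrees \<open>d < p + q\<close>, where multiplication by \<open>l\<close> is injective, and \<open>d + 1 \<ge> p + q\<close>,
  where it is surjective, cover all integers.\<close>

theorem weak_Lefschetz_if_binomial_nonzero:
  assumes "\<alpha> + \<beta> + \<gamma> = p + q" and "\<beta> \<le> q"
    and "of_nat (\<gamma> choose (q - \<beta>)) \<noteq> (0 :: 'k::field)"
  defines "I \<equiv> (I_ideal (int (Suc p)) (int (Suc q)) (int (Suc (p + q))) (int \<alpha>) (int \<beta>) (int \<gamma>)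
    :: 'k poly3 set)"
  shows "weak_Lefschetz (poly3_ring Quot I) (quotient_part I)"
proof (rule weak_Lefschetz_quotientI[where l = lin])
  show "ideal I poly3_ring"
    unfolding I_def by (rule I_ideal_is_ideal)
  show "(lin :: 'k poly3) \<in> homogeneous_part 1"
    using lin_mult_homogeneous[of 1 0] by (simp add: homogeneous_part_def mdegree_def)
  show "lin * f \<in> homogeneous_part (d + 1)" if "f \<in> homogeneous_part d" for d and f :: "'k poly3"
    using that by (rule lin_mult_homogeneous)
  have w: "weight q \<beta> \<gamma> \<noteq> (0 :: 'k)"
    using assms by (simp add: weight_def)
  have I_iff: "f \<in> I \<longleftrightarrow>
      Poly_Mapping.keys f \<subseteq> multiples (Suc p) (Suc q) (Suc (p + q)) \<alpha> \<beta> \<gamma>" for f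
    by (simp only: I_def I_ideal_eq nat_int mem_Collect_eq)
  fix d
  show "(\<forall>f\<in>homogeneous_part d. lin * f \<in> I \<longrightarrow> f \<in> I) \<or>
      (\<forall>g\<in>homogeneous_part (d + 1). \<exists>f\<in>homogeneous_part d. g - lin * f \<in> I)"
  proof (cases "d < int (p + q)")
    case True
    then show ?thesis
      unfolding I_iff using lin_mult_injective[OF assms(1) w] by blast
  next
    case False
    then show ?thesis
      unfolding I_iff using lin_mult_surjective[OF assms(1) w, of d] by force
  qed
qed

theorem proposition8p2:
  fixes n \<beta> c :: int
  assumes "n > 0" and "\<beta> \<ge> 0" and "c \<ge> n + \<beta> + 1"
    and "\<not> (c - n - \<beta> - 1 = 0 \<and> \<beta> = 0)"
  shows "det (N_mat (c - \<beta> - 1) (\<beta> + 2) c (c - n - \<beta> - 1) \<beta> n) = n \<and>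
    (infinite (UNIV :: 'k::field set) \<longrightarrow>
     CHAR('k) = 0 \<or> \<not> (prime CHAR('k) \<and> int CHAR('k) dvd n) \<longrightarrow>
     (let I = (I_ideal (c - \<beta> - 1) (\<beta> + 2) c (c - n - \<beta> - 1) \<beta> n :: 'k poly3 set)
      in weak_Lefschetz (poly3_ring Quot I) (quotient_part I)))"
proof (intro conjI impI)
  have "par_s (c - \<beta> - 1) (\<beta> + 2) c (c - n - \<beta> - 1) \<beta> n = c - 2"
    by (simp add: par_s_def)
  then have "N_mat (c - \<beta> - 1) (\<beta> + 2) c (c - n - \<beta> - 1) \<beta> n = mat 1 1 (\<lambda>_. n)"
    using assms(1)
    by (intro eq_matI) (simp_all add: N_mat_def par_A_def par_C_def par_M_def int_binomial_def)
  then show "det (N_mat (c - \<beta> - 1) (\<beta> + 2) c (c - n - \<beta> - 1) \<beta> n) = n"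
    by (simp add: det_single)
next
  assume char: "CHAR('k) = 0 \<or> \<not> (prime CHAR('k) \<and> int CHAR('k) dvd n)"
  obtain n' \<beta>' \<alpha>' where n': "n = int n'" and \<beta>': "\<beta> = int \<beta>'" and "c - n - \<beta> - 1 = int \<alpha>'"
    using assms zero_le_imp_eq_int by (metis diff_ge_0_iff_ge diff_diff_eq less_imp_le)
  then have \<alpha>': "c = int \<alpha>' + int n' + int \<beta>' + 1"
    by simp
  \<comment> \<open>A nonzero characteristic of a field is prime, so by hypothesis it does not divide \<open>n\<close>.\<close>
  have "of_nat n' \<noteq> (0 :: 'k)"
    using char assms(1) prime_CHAR_semidom[where 'a = 'k]
    by (auto simp: of_nat_eq_0_iff_char_dvd n')
  then have WL: "weak_Lefschetz (poly3_ring Quot I) (quotient_part I)"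
    if "I = (I_ideal (int (Suc (\<alpha>' + n' - 1))) (int (Suc (Suc \<beta>'))) (int (Suc (\<alpha>' + n' - 1 + Suc \<beta>')))
      (int \<alpha>') (int \<beta>') (int n') :: 'k poly3 set)" for I
    unfolding that using assms(1) by (intro weak_Lefschetz_if_binomial_nonzero) (simp_all add: n')
  have "int (Suc (\<alpha>' + n' - 1)) = c - \<beta> - 1" "int (Suc (Suc \<beta>')) = \<beta> + 2"
    "int (Suc (\<alpha>' + n' - 1 + Suc \<beta>')) = c" "int \<alpha>' = c - n - \<beta> - 1"
    using assms(1) by (simp_all add: n' \<beta>' \<alpha>' of_nat_diff)
  then show "let I = (I_ideal (c - \<beta> - 1) (\<beta> + 2) c (c - n - \<beta> - 1) \<beta> n :: 'k poly3 set)
      in weak_Lefschetz (poly3_ring Quot I) (quotient_part I)"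
    unfolding Let_def by (intro WL) (simp only: n' \<beta>')
qed

end
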